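(* Let $(\Omega,\mathcal{F},P)$ be a probability space, $(B,\|\cdot\|)$ a Banach space over $\mathbb{K}$ ($\mathbb{K}=\mathbb{R}$ or $\mathbb{C}$), $V$ a weakly compact convex subset with normal structure of $B$, and $\mathcal{T}$ a family of strong random surjective isometric operators from $\Omega\times V$ to $V$. Then there is a strong random element $x^0(\cdot):\Omega\to c(V,V)$ such that $T(\omega,x^0(\omega))=x^0(\omega)$ for almost all $\omega\in\Omega$ and all $T\in\mathcal{T}$.
   Context: Chebyshev center: for a nonempty bounded $K\subset B$ and nonempty $F\subset B$, $r(K,x)=\sup\{\|x-y\|:y\in K\}$ for $x\in B$, $r(K,F)=\inf\{r(K,x):x\in F\}$, and $c(K,F)=\{x\in F:r(K,x)=r(K,F)\}$; $c(V,V)$ is the Chebyshev center of $V$. Normal structure: a nonempty bounded closed convex set $K\subset B$ has normal structure if every nonempty closed convex subset $F$ of $K$ containing more than one point has a point $x\in F$ with $r(F,x)<\sup\{\|z-y\|:y,z\in F\}$. For a metric space $M$, a map $X:\Omega\to M$ is a random element if $X^{-1}(U)\in\mathcal{F}$ for each open $U\subset M$; a random element is simple if it takes only finitely many values; $X$ is a strong random element if it is the pointwise limit of a sequence of simple random elements (equivalently, it is a random element with separable range). For metric spaces $(M,d)$, $(M_1,d_1)$, a map $T:\Omega\times M\to M_1$ is a random operator if $T(\cdot,x)$ is a random element for each $x\in M$, and a strong random operator if $T(\cdot,x)$ is a strong random element for each $x\in M$; it is random isometric if for each $\omega\in\Omega$, $d_1(T(\omega,x),T(\omega,y))=d(x,y)$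 for all $x,y\in M$; it is surjective if $T(\omega,\cdot):M\to M_1$ is surjective for each $\omega\in\Omega$. A strong random surjective isometric operator has all these properties. Here $V$ carries the metric induced by the norm. *)

theory Defs
  imports "HOL-Analysis.Analysis" "HOL-Probability.Probability"
begin

text \<open>The class of scalar fields that are \<open>\<real>\<close> or \<open>\<complex>\<close>. In the second case, multiplicativity of the
  norm forces it to be the modulus.\<close>

class real_or_complex = real_normed_field +
  assumes real_or_complex:
    "(\<forall>z. \<exists>a. z = a *\<^sub>R 1) \<or>
     (\<exists>j. j * j = - 1 \<and> (\<forall>z. \<exists>a b. z = a *\<^sub>R 1 + b *\<^sub>R j))"

instance real :: real_or_complex
  by standard simp

instance complex :: real_or_complex
proof
  have "z = Re z *\<^sub>R 1 + Im z *\<^sub>R \<i>" for z :: complex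
    by (simp add: complex_eq_iff)
  then have "\<forall>z::complex. \<exists>a b. z = a *\<^sub>R 1 + b *\<^sub>R \<i>"
    by blast
  then show "(\<forall>z::complex. \<exists>a. z = a *\<^sub>R 1) \<or>
     (\<exists>j::complex. j * j = - 1 \<and> (\<forall>z. \<exists>a b. z = a *\<^sub>R 1 + b *\<^sub>R j))"
    by (intro disjI2 exI[of _ \<i>]) simp
qed

text \<open>A Banach space over the scalar field \<open>'k\<close>. The type class \<open>banach\<close> supplies the norm, completeness
  and the scalar multiplication by reals, of which \<open>smul\<close> is required to be an extension.\<close>

locale banach_space_over = vector_space smul
  for smul :: "'k::real_or_complex \<Rightarrow> 'b::banach \<Rightarrow> 'b" +
  assumes norm_scale: "norm (smul a x) = norm a * norm x"
    and scale_of_real: "smul (of_real r) x = r *\<^sub>R x"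

definition weak_topology :: "('k::real_or_complex \<Rightarrow> 'b::banach \<Rightarrow> 'b) \<Rightarrow> 'b topology" where
  "weak_topology smul = topology_generated_by
     {f -` U | (f :: 'b \<Rightarrow> 'k) U.
        Vector_Spaces.linear smul (*) f \<and> continuous_on UNIV f \<and> open U}"

text \<open>The suprema and infima below are taken in the reals, hence are meaningful only for nonempty
  bounded \<open>K\<close> and nonempty \<open>F\<close>.\<close>

definition cheb_radius_at :: "'b::real_normed_vector set \<Rightarrow> 'b \<Rightarrow> real" where
  "cheb_radius_at K x = (SUP y\<in>K. norm (x - y))"

definition cheb_radius :: "'b::real_normed_vector set \<Rightarrow> 'b set \<Rightarrow> real" where
  "cheb_radius K F = (INF x\<in>F. cheb_radius_at K x)"

definition cheb_center :: "'b::real_normed_vector set \<Rightarrow> 'b set \<Rightarrow> 'b set" where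
  "cheb_center K F = {x \<in> F. cheb_radius_at K x = cheb_radius K F}"

definition normal_structure :: "'b::real_normed_vector set \<Rightarrow> bool" where
  "normal_structure K \<longleftrightarrow>
     K \<noteq> {} \<and> bounded K \<and> closed K \<and> convex K \<and>
     (\<forall>F. F \<subseteq> K \<and> F \<noteq> {} \<and> closed F \<and> convex F \<and> (\<exists>u\<in>F. \<exists>v\<in>F. u \<noteq> v) \<longrightarrow>
        (\<exists>x\<in>F. cheb_radius_at F x < (SUP (z, y)\<in>F \<times> F. norm (z - y))))"

text \<open>The metric space \<open>M\<close> is a subset of a metric type, with the induced metric. Functions on \<open>\<Omega>\<close>
  are constrained only on \<open>space P\<close>.\<close>

definition random_element :: "'w measure \<Rightarrow> 'm::metric_space set \<Rightarrow> ('w \<Rightarrow> 'm) \<Rightarrow> bool" where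
  "random_element P M X \<longleftrightarrow>
     X \<in> space P \<rightarrow> M \<and>
     (\<forall>U. openin (top_of_set M) U \<longrightarrow> X -` U \<inter> space P \<in> sets P)"

definition simple_random_element :: "'w measure \<Rightarrow> 'm::metric_space set \<Rightarrow> ('w \<Rightarrow> 'm) \<Rightarrow> bool" where
  "simple_random_element P M X \<longleftrightarrow> random_element P M X \<and> finite (X ` space P)"

definition strong_random_element :: "'w measure \<Rightarrow> 'm::metric_space set \<Rightarrow> ('w \<Rightarrow> 'm) \<Rightarrow> bool" where
  "strong_random_element P M X \<longleftrightarrow>
     X \<in> space P \<rightarrow> M \<and>
     (\<exists>S. (\<forall>n. simple_random_element P M (S n)) \<and>
          (\<forall>\<omega>\<in>space P. (\<lambda>n. S n \<omega>) \<longlonglongrightarrow> X \<omega>))"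

definition strong_random_operator ::
    "'w measure \<Rightarrow> 'm::metric_space set \<Rightarrow> 'n::metric_space set \<Rightarrow> ('w \<Rightarrow> 'm \<Rightarrow> 'n) \<Rightarrow> bool" where
  "strong_random_operator P M N T \<longleftrightarrow> (\<forall>x\<in>M. strong_random_element P N (\<lambda>\<omega>. T \<omega> x))"

definition random_isometric ::
    "'w measure \<Rightarrow> 'm::metric_space set \<Rightarrow> ('w \<Rightarrow> 'm \<Rightarrow> 'n::metric_space) \<Rightarrow> bool" where
  "random_isometric P M T \<longleftrightarrow>
     (\<forall>\<omega>\<in>space P. \<forall>x\<in>M. \<forall>y\<in>M. dist (T \<omega> x) (T \<omega> y) = dist x y)"

definition random_surjective ::
    "'w measure \<Rightarrow> 'm set \<Rightarrow> 'n set \<Rightarrow> ('w \<Rightarrow> 'm \<Rightarrow> 'n) \<Rightarrow> bool" where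
  "random_surjective P M N T \<longleftrightarrow> (\<forall>\<omega>\<in>space P. T \<omega> ` M = N)"

definition strong_random_surjective_isometric_operator ::
    "'w measure \<Rightarrow> 'm::metric_space set \<Rightarrow> 'n::metric_space set \<Rightarrow> ('w \<Rightarrow> 'm \<Rightarrow> 'n) \<Rightarrow> bool" where
  "strong_random_surjective_isometric_operator P M N T \<longleftrightarrow>
     strong_random_operator P M N T \<and> random_isometric P M T \<and> random_surjective P M N T"

end

theory Submission
  imports Defs
begin

text \<open>
  The fixed point does not have to depend on \<open>\<omega>\<close>. By the theorem of Brodskii and Milman, all
  surjective isometries of a weakly compact convex set \<open>V\<close> with normal structure have a common fixed
  point in the Chebyshev center of \<open>V\<close> (\<open>common_fixed_point_in_cheb_center\<close>). The constant function
  at this point is a strong random element, and it is fixed by every \<open>T \<omega>\<close> with \<open>T\<close> in the family,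
  because each such \<open>T \<omega>\<close> is a surjective isometry of \<open>V\<close>.

  For the deterministic theorem, call a set invariant if every surjective isometry of \<open>V\<close> maps it
  onto itself. The Chebyshev center \<open>c(C,C)\<close> of an invariant set is defined by distances within
  \<open>C\<close>, so it is again invariant (\<open>isometry_image_cheb_center\<close>). Zorn's lemma gives a minimal
  nonempty closed convex invariant set \<open>C \<subseteq> c(V,V)\<close> (\<open>exists_minimal_invariant_set\<close>). Minimality
  forces \<open>c(C,C) = C\<close>, that is, all points of \<open>C\<close> have the same farthest distance within \<open>C\<close>, which
  is then the diameter of \<open>C\<close>. Normal structure excludes this unless \<open>C\<close> is a single point
  (\<open>normal_structure_self_center_singleton\<close>), and this point is fixed by all the isometries. Since
  the isometries need not be affine, an average over an orbit need not be fixed.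

  Weak compactness enters twice, for the nonemptiness of Chebyshev centers and for the lower bounds of
  chains in Zorn's lemma, both times because a chain of nonempty closed convex subsets of \<open>V\<close> has a
  common point (\<open>weakly_compact_chain_Inter_nonempty\<close>). This needs Mazur's theorem that closed convex
  sets are weakly closed (\<open>closedin_weak_topology_closed_convex\<close>), which follows from a Hahn--Banach
  separation theorem for real functionals and the passage from real to \<open>'k\<close>-linear functionals.
\<close>

section \<open>Hahn--Banach separation\<close>

lemma le_INF_add_INF:
  fixes c :: real
  assumes "I \<noteq> {}" "J \<noteq> {}" and le: "\<And>i j. i \<in> I \<Longrightarrow> j \<in> J \<Longrightarrow> c \<le> f i + g j"
  shows "c \<le> (INF i\<in>I. f i) + (INF j\<in>J. g j)"
proof -
  have "c - f i \<le> (INF j\<in>J. g j)" if "i \<in> I" for i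
  proof (rule cINF_greatest[OF assms(2)])
    show "c - f i \<le> g j" if "j \<in> J" for j
      using le[OF \<open>i \<in> I\<close> that] by simp
  qed
  then have "c - (INF j\<in>J. g j) \<le> f i" if "i \<in> I" for i
    using that by (smt (verit))
  then have "c - (INF j\<in>J. g j) \<le> (INF i\<in>I. f i)"
    by (rule cINF_greatest[OF assms(1)])
  then show ?thesis by simp
qed

lemma le_mult_INF:
  fixes c :: real
  assumes "I \<noteq> {}" "s > 0" and le: "\<And>i. i \<in> I \<Longrightarrow> c \<le> s * f i"
  shows "c \<le> s * (INF i\<in>I. f i)"
proof -
  have "c / s \<le> (INF i\<in>I. f i)"
  proof (rule cINF_greatest[OF assms(1)])
    show "c / s \<le> f i" if "i \<in> I" for i
      using le[OF that] assms(2) by (simp add: pos_divide_le_eq mult.commute)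
  qed
  then show ?thesis
    using assms(2) by (simp add: pos_divide_le_eq mult.commute)
qed

lemma Chains_relation_ofD:
  assumes "C \<in> Chains (relation_of P A)"
  shows "C \<subseteq> A" "\<And>x y. x \<in> C \<Longrightarrow> y \<in> C \<Longrightarrow> P x y \<or> P y x"
  using assms by (auto simp: Chains_def relation_of_def)

definition sublinear_functional :: "('b::real_vector \<Rightarrow> real) \<Rightarrow> bool" where
  "sublinear_functional p \<longleftrightarrow>
     (\<forall>x y. p (x + y) \<le> p x + p y) \<and> (\<forall>t>0. \<forall>x. p (t *\<^sub>R x) \<le> t * p x)"

lemma sublinear_functional_add: "sublinear_functional p \<Longrightarrow> p (x + y) \<le> p x + p y"
  by (simp add: sublinear_functional_def)

lemma sublinear_functional_scaleR_le: "sublinear_functional p \<Longrightarrow> t > 0 \<Longrightarrow> p (t *\<^sub>R x) \<le> t * p x"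
  by (simp add: sublinear_functional_def)

lemma sublinear_functional_zero:
  assumes "sublinear_functional p"
  shows "p 0 = 0"
  using sublinear_functional_scaleR_le[OF assms, of 2 0]
    sublinear_functional_scaleR_le[OF assms, of "1/2" 0] by simp

lemma sublinear_functional_minus:
  assumes "sublinear_functional p"
  shows "- p (- x) \<le> p x"
  using sublinear_functional_add[OF assms, of x "- x"] sublinear_functional_zero[OF assms] by simp

lemma sublinear_functional_scaleR:
  assumes "sublinear_functional p" "t > 0"
  shows "p (t *\<^sub>R x) = t * p x"
proof (rule antisym)
  have "p x \<le> inverse t * p (t *\<^sub>R x)"
    using sublinear_functional_scaleR_le[OF assms(1), of "inverse t" "t *\<^sub>R x"] assms(2) by simp
  then show "t * p x \<le> p (t *\<^sub>R x)"
    using assms(2) by (simp add: field_simps)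
qed (rule sublinear_functional_scaleR_le[OF assms])

text \<open>Subadditivity survives the infimum because two members of a chain can be replaced by the
  smaller one.\<close>

lemma sublinear_functional_INF_chain:
  assumes sub: "\<And>q. q \<in> C \<Longrightarrow> sublinear_functional q"
    and chain: "\<And>q r. q \<in> C \<Longrightarrow> r \<in> C \<Longrightarrow> q \<le> r \<or> r \<le> q"
    and ne: "C \<noteq> {}"
    and bdd: "\<And>x. bdd_below ((\<lambda>q. q x) ` C)"
  shows "sublinear_functional (\<lambda>x. INF q\<in>C. q x)"
  unfolding sublinear_functional_def
proof (intro conjI allI impI)
  let ?u = "\<lambda>x. INF q\<in>C. q x"
  have lower: "?u x \<le> q x" if "q \<in> C" for q x
    using bdd that by (rule cINF_lower)
  fix x y
  have "?u (x + y) \<le> q x + r y" if q: "q \<in> C" and r: "r \<in> C" for q r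
  proof -
    obtain s where s: "s \<in> C" "s \<le> q" "s \<le> r"
      using chain[OF q r] q r by blast
    have "?u (x + y) \<le> s (x + y)" using lower s(1) .
    also have "\<dots> \<le> s x + s y" using sub[OF s(1)] by (rule sublinear_functional_add)
    also have "\<dots> \<le> q x + r y" using s(2,3) by (auto simp: le_fun_def intro: add_mono)
    finally show ?thesis .
  qed
  then show "?u (x + y) \<le> ?u x + ?u y"
    by (rule le_INF_add_INF[OF ne ne])
next
  let ?u = "\<lambda>x. INF q\<in>C. q x"
  fix t :: real and x
  assume t: "t > 0"
  have "?u (t *\<^sub>R x) \<le> t * q x" if "q \<in> C" for q
  proof -
    have "?u (t *\<^sub>R x) \<le> q (t *\<^sub>R x)" using bdd that by (rule cINF_lower)
    also have "\<dots> \<le> t * q x" using sub[OF that] t by (rule sublinear_functional_scaleR_le)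
    finally show ?thesis .
  qed
  then show "?u (t *\<^sub>R x) \<le> t * ?u x"
    by (rule le_mult_INF[OF ne t])
qed

lemma exists_minimal_sublinear_functional:
  assumes p: "sublinear_functional p"
  obtains q where "sublinear_functional q" "q \<le> p"
    "\<And>r. sublinear_functional r \<Longrightarrow> r \<le> q \<Longrightarrow> r = q"
proof -
  let ?A = "{q. sublinear_functional q \<and> q \<le> p}"
  have "\<exists>u\<in>?A. \<forall>q\<in>C. q \<ge> u" if C: "C \<in> Chains (relation_of (\<ge>) ?A)" for C
  proof (cases "C = {}")
    case True
    then show ?thesis using p by auto
  next
    case False
    have CA: "C \<subseteq> ?A" and chain: "\<And>q r. q \<in> C \<Longrightarrow> r \<in> C \<Longrightarrow> q \<le> r \<or> r \<le> q"
      using Chains_relation_ofD[OF C] by auto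
    \<comment> \<open>This bound does not depend on \<open>q\<close>, so the pointwise infimum of the chain is finite.\<close>
    have "- p (- x) \<le> q x" if "q \<in> C" for q x
    proof -
      have "q (- x) \<le> p (- x)" using that CA by (auto simp: le_fun_def)
      moreover have "- q (- x) \<le> q x" using that CA by (intro sublinear_functional_minus) auto
      ultimately show ?thesis by simp
    qed
    then have bdd: "bdd_below ((\<lambda>q. q x) ` C)" for x
      by (intro bdd_belowI2)
    let ?u = "\<lambda>x. INF q\<in>C. q x"
    have "sublinear_functional ?u"
      using CA chain False bdd by (intro sublinear_functional_INF_chain) auto
    moreover have le: "?u \<le> q" if "q \<in> C" for q
      using bdd that by (auto simp: le_fun_def intro: cINF_lower)
    moreover have "?u \<le> p"
      using False CA le order_trans by blast
    ultimately show ?thesis by blast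
  qed
  moreover have "partial_order_on ?A (relation_of (\<ge>) ?A)"
    by (rule partial_order_on_relation_ofI) auto
  ultimately obtain q where "q \<in> ?A" "\<forall>r\<in>?A. q \<ge> r \<longrightarrow> r = q"
    using predicate_Zorn[of ?A "(\<ge>)"] by blast
  then show thesis
    by (intro that[of q]) (auto intro: order_trans)
qed

text \<open>A sublinear \<open>q\<close> can be lowered in the direction of \<open>y\<close> to
  \<open>x \<mapsto> inf (q (x + t y) - t q y)\<close> over \<open>t \<ge> 0\<close>, whose value at \<open>- y\<close> is at most \<open>- q y\<close>. So
  a minimal \<open>q\<close> is odd, and an odd subadditive function is additive.\<close>

lemma minimal_sublinear_functional_linear:
  assumes q: "sublinear_functional q"
    and min: "\<And>r. sublinear_functional r \<Longrightarrow> r \<le> q \<Longrightarrow> r = q"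
  shows "linear q"
proof -
  have neg: "q (- y) = - q y" for y
  proof -
    let ?g = "\<lambda>x t. q (x + t *\<^sub>R y) - t * q y"
    let ?r = "\<lambda>x. INF t\<in>{0..}. ?g x t"
    have "- q (- x) \<le> ?g x t" if "t \<ge> 0" for x t
    proof -
      have "t * q y = q (t *\<^sub>R y)"
        using that q sublinear_functional_scaleR[OF q, of t y] sublinear_functional_zero[OF q]
        by (cases "t = 0") auto
      also have "\<dots> \<le> q (x + t *\<^sub>R y) + q (- x)"
        using sublinear_functional_add[OF q, of "x + t *\<^sub>R y" "- x"] by simp
      finally show ?thesis by simp
    qed
    then have bdd: "bdd_below (?g x ` {0..})" for x
      by (intro bdd_belowI2[where m = "- q (- x)"]) auto
    have lower: "?r x \<le> ?g x t" if "t \<ge> 0" for x t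
      using that by (intro cINF_lower bdd) auto
    have "sublinear_functional ?r"
      unfolding sublinear_functional_def
    proof (intro conjI allI impI)
      fix x z
      have "?r (x + z) \<le> ?g x s + ?g z t" if "s \<ge> 0" "t \<ge> 0" for s t
      proof -
        have "?r (x + z) \<le> ?g (x + z) (s + t)" using that by (intro lower) simp
        also have "\<dots> \<le> ?g x s + ?g z t"
          using sublinear_functional_add[OF q, of "x + s *\<^sub>R y" "z + t *\<^sub>R y"]
          by (simp add: algebra_simps)
        finally show ?thesis .
      qed
      then show "?r (x + z) \<le> ?r x + ?r z"
        by (intro le_INF_add_INF) auto
    next
      fix s :: real and x
      assume s: "s > 0"
      have "?r (s *\<^sub>R x) \<le> s * ?g x t" if "t \<ge> 0" for t
      proof -
        have "?r (s *\<^sub>R x) \<le> ?g (s *\<^sub>R x) (s * t)" using s that by (intro lower) simp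
        also have "\<dots> = q (s *\<^sub>R (x + t *\<^sub>R y)) - s * t * q y" by (simp add: algebra_simps)
        also have "\<dots> = s * ?g x t"
          by (simp only: sublinear_functional_scaleR[OF q s] right_diff_distrib mult.assoc)
        finally show ?thesis .
      qed
      then show "?r (s *\<^sub>R x) \<le> s * ?r x"
        using s by (intro le_mult_INF) auto
    qed
    moreover have "?r \<le> q"
      using lower[of 0] by (simp add: le_fun_def)
    ultimately have "?r = q" by (rule min)
    then have "?r (- y) = q (- y)" by (rule fun_cong)
    then have "q (- y) \<le> ?g (- y) 1"
      using lower[of 1 "- y"] by simp
    then have "q (- y) \<le> - q y"
      using sublinear_functional_zero[OF q] by simp
    then show ?thesis
      using sublinear_functional_minus[OF q, of y] by simp
  qed
  have add: "q (x + y) = q x + q y" for x y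
  proof (rule antisym)
    have "q (- x + - y) \<le> q (- x) + q (- y)" using q by (rule sublinear_functional_add)
    moreover have "- x + - y = - (x + y)" by simp
    ultimately show "q x + q y \<le> q (x + y)" by (simp only: neg)
  qed (rule sublinear_functional_add[OF q])
  have scale: "q (t *\<^sub>R x) = t *\<^sub>R q x" for t x
  proof -
    consider "t > 0" | "t = 0" | "t < 0" by linarith
    then show ?thesis
    proof cases
      case 3
      then show ?thesis
        using sublinear_functional_scaleR[OF q, of "- t" x] by (simp add: neg)
    qed (simp_all add: sublinear_functional_scaleR[OF q] sublinear_functional_zero[OF q])
  qed
  show ?thesis
    using add scale by (rule linearI)
qed

lemma sublinear_functional_dominates_linear:
  assumes "sublinear_functional p"
  obtains f where "linear f" "\<And>x. f x \<le> p x"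
proof -
  obtain q where q: "sublinear_functional q" "q \<le> p"
    "\<And>r. sublinear_functional r \<Longrightarrow> r \<le> q \<Longrightarrow> r = q"
    using exists_minimal_sublinear_functional[OF assms] by blast
  show thesis
    using minimal_sublinear_functional_linear[OF q(1,3)] q(2)
    by (intro that[of q]) (auto simp: le_fun_def)
qed

text \<open>The functional is dominated by \<open>p x = inf (\<parallel>x + t c\<parallel> - t d)\<close> over \<open>t \<ge> 0\<close> and \<open>c \<in> C\<close>: taking
  \<open>t = 0\<close> gives \<open>p \<le> \<parallel>\<cdot>\<parallel>\<close>, hence boundedness, and taking \<open>t = 1\<close> gives \<open>p (- c) \<le> - d\<close>.\<close>

lemma separating_functional_from_zero:
  fixes C :: "'b::real_normed_vector set"
  assumes C: "convex C" "C \<noteq> {}" and d: "\<And>c. c \<in> C \<Longrightarrow> d \<le> norm c"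
  obtains f where "bounded_linear f" "\<And>c. c \<in> C \<Longrightarrow> d \<le> f c"
proof -
  let ?I = "{0::real..} \<times> C"
  let ?g = "\<lambda>x (t, c). norm (x + t *\<^sub>R c) - t * d"
  let ?p = "\<lambda>x. INF i\<in>?I. ?g x i"
  obtain c0 where c0: "c0 \<in> C" using C(2) by auto
  then have "(0, c0) \<in> ?I" by simp
  then have I: "?I \<noteq> {}" by blast
  have "- norm x \<le> ?g x (t, c)" if "t \<ge> 0" "c \<in> C" for x t c
  proof -
    have "t * d \<le> t * norm c" using that d by (intro mult_left_mono) auto
    also have "\<dots> = norm (t *\<^sub>R c)" using that by simp
    also have "\<dots> \<le> norm (x + t *\<^sub>R c) + norm x"
      using norm_triangle_ineq4[of "x + t *\<^sub>R c" x] by simp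
    finally show ?thesis by simp
  qed
  then have bdd: "bdd_below (?g x ` ?I)" for x
    by (intro bdd_belowI2[where m = "- norm x"]) auto
  have lower: "?p x \<le> norm (x + t *\<^sub>R c) - t * d" if "t \<ge> 0" "c \<in> C" for x t c
    using cINF_lower[OF bdd, of "(t, c)" x] that by simp
  have "sublinear_functional ?p"
    unfolding sublinear_functional_def
  proof (intro conjI allI impI)
    fix x y
    have *: "?p (x + y) \<le> ?g x (s, c) + ?g y (t, e)"
      if st: "s \<ge> 0" "t \<ge> 0" "c \<in> C" "e \<in> C" for s t c e
    proof -
      \<comment> \<open>By convexity, the sum of two nonnegative multiples of points of \<open>C\<close> is a multiple of a
        point of \<open>C\<close>.\<close>
      obtain k where k: "k \<in> C" "s *\<^sub>R c + t *\<^sub>R e = (s + t) *\<^sub>R k"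
      proof (cases "s + t = 0")
        case True
        then have "s = 0" "t = 0" using st by auto
        then show thesis using st by (intro that[of c]) auto
      next
        case False
        have "(s / (s + t)) *\<^sub>R c + (t / (s + t)) *\<^sub>R e \<in> C"
          using C(1) st False by (intro convexD) (auto simp flip: add_divide_distrib)
        then show thesis using False
          by (intro that) (auto simp: scaleR_add_right)
      qed
      have "?p (x + y) \<le> norm (x + y + (s + t) *\<^sub>R k) - (s + t) * d"
        using st k by (intro lower) auto
      also have "x + y + (s + t) *\<^sub>R k = (x + s *\<^sub>R c) + (y + t *\<^sub>R e)"
        unfolding k(2)[symmetric] by (simp add: algebra_simps)
      also have "norm \<dots> - (s + t) * d \<le> ?g x (s, c) + ?g y (t, e)"
        using norm_triangle_ineq[of "x + s *\<^sub>R c" "y + t *\<^sub>R e"] by (simp add: algebra_simps)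
      finally show ?thesis .
    qed
    show "?p (x + y) \<le> ?p x + ?p y"
    proof (rule le_INF_add_INF[OF I I])
      show "?p (x + y) \<le> ?g x i + ?g y j" if "i \<in> ?I" "j \<in> ?I" for i j
        using that *[of "fst i" "fst j" "snd i" "snd j"] by (cases i; cases j) simp
    qed
  next
    fix s :: real and x
    assume s: "s > 0"
    have "?p (s *\<^sub>R x) \<le> s * ?g x i" if iI: "i \<in> ?I" for i
    proof -
      obtain t c where i: "i = (t, c)" "t \<ge> 0" "c \<in> C" using iI by auto
      have "?p (s *\<^sub>R x) \<le> norm (s *\<^sub>R x + (s * t) *\<^sub>R c) - s * t * d"
        using s i by (intro lower) auto
      also have "s *\<^sub>R x + (s * t) *\<^sub>R c = s *\<^sub>R (x + t *\<^sub>R c)" by (simp add: algebra_simps)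
      also have "norm \<dots> - s * t * d = s * ?g x i"
        using s by (simp add: i(1) right_diff_distrib del: scaleR_add_right)
      finally show ?thesis .
    qed
    then show "?p (s *\<^sub>R x) \<le> s * ?p x"
      by (rule le_mult_INF[OF I s])
  qed
  then obtain f where f: "linear f" "\<And>x. f x \<le> ?p x"
    by (rule sublinear_functional_dominates_linear) blast
  have le: "f x \<le> norm x" for x
    using order_trans[OF f(2) lower[of 0 c0 x]] c0 by simp
  have "bounded_linear f"
  proof (rule bounded_linear_intro)
    show "norm (f x) \<le> norm x * 1" for x
      using le[of x] le[of "- x"] linear_neg[OF f(1)] by simp
  qed (use linear_add[OF f(1)] linear_cmul[OF f(1)] in auto)
  moreover have "d \<le> f c" if "c \<in> C" for c
    using order_trans[OF f(2) lower[of 1 c "- c"]] that linear_neg[OF f(1)] by simp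
  ultimately show thesis by (rule that)
qed

lemma separating_functional:
  fixes C :: "'b::real_normed_vector set"
  assumes "closed C" "convex C" "x \<notin> C"
  obtains f :: "'b \<Rightarrow> real" and a where "bounded_linear f" "f x < a" "\<And>c. c \<in> C \<Longrightarrow> a \<le> f c"
proof (cases "C = {}")
  case True
  then show thesis using that[of "\<lambda>_. 0" 1] by simp
next
  case False
  obtain d where d: "d > 0" "ball x d \<subseteq> - C"
    using assms open_contains_ball[of "- C"] by auto
  have "d \<le> norm c" if "c \<in> (\<lambda>c. c - x) ` C" for c
    using that d(2) by (force simp: dist_norm norm_minus_commute not_less[symmetric])
  then obtain f where f: "bounded_linear f" "\<And>c. c \<in> (\<lambda>c. c - x) ` C \<Longrightarrow> d \<le> f c"
    using separating_functional_from_zero[of "(\<lambda>c. c - x) ` C" d] assms(2) False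
    by (auto intro: convex_translation_subtract)
  have "f x + d \<le> f c" if "c \<in> C" for c
    using f(2)[of "c - x"] that linear_diff[OF bounded_linear.linear[OF f(1)]] by simp
  then show thesis
    using that[OF f(1), of "f x + d"] d(1) by simp
qed

section \<open>Weak closedness and chains of closed convex sets\<close>

text \<open>The modulus of \<open>a + b j\<close> is recovered from multiplicativity of the norm,
  \<open>\<parallel>a + b j\<parallel> \<parallel>a - b j\<parallel> = a\<^sup>2 + b\<^sup>2\<close>; the weaker bound given here is enough to make the real part
  well defined and continuous.\<close>

lemma real_part_bound:
  fixes j :: "'k::real_normed_field"
  assumes j: "j * j = - 1"
  shows "\<bar>a\<bar> + \<bar>b\<bar> \<le> 2 * norm (a *\<^sub>R 1 + b *\<^sub>R j)"
proof (cases "\<bar>a\<bar> + \<bar>b\<bar> = 0")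
  case False
  let ?s = "\<bar>a\<bar> + \<bar>b\<bar>" and ?z = "a *\<^sub>R 1 + b *\<^sub>R j"
  have "norm j * norm j = 1" using j by (metis norm_minus_cancel norm_mult norm_one)
  then have nj: "norm j = 1"
    by (metis abs_norm_cancel abs_square_eq_1 power2_eq_square)
  have "(a *\<^sub>R 1 - b *\<^sub>R j) * ?z = (a\<^sup>2 + b\<^sup>2) *\<^sub>R 1"
    using j by (simp add: algebra_simps power2_eq_square)
  then have "a\<^sup>2 + b\<^sup>2 = norm (a *\<^sub>R 1 - b *\<^sub>R j) * norm ?z"
    by (metis norm_mult norm_scaleR norm_one mult.right_neutral abs_of_nonneg sum_power2_ge_zero)
  also have "\<dots> \<le> ?s * norm ?z"
  proof (rule mult_right_mono)
    show "norm (a *\<^sub>R 1 - b *\<^sub>R j) \<le> ?s"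
      using norm_triangle_ineq4[of "a *\<^sub>R 1" "b *\<^sub>R j"] nj by simp
  qed simp
  finally have "2 * (a\<^sup>2 + b\<^sup>2) \<le> ?s * (2 * norm ?z)" by simp
  moreover have "?s * ?s \<le> 2 * (a\<^sup>2 + b\<^sup>2)"
    using zero_le_power2[of "\<bar>a\<bar> - \<bar>b\<bar>"] by (simp add: power2_eq_square algebra_simps)
  ultimately have "?s * ?s \<le> ?s * (2 * norm ?z)" by linarith
  moreover have "?s > 0" using False by linarith
  ultimately show ?thesis by (simp add: mult_le_cancel_left)
next
  case True
  then show ?thesis by (smt (verit) norm_ge_zero)
qed

text \<open>Over complex scalars the functional is the classical \<open>g x = f x - f (j x) j\<close>, and the map
  that recovers \<open>f\<close> from it is the real part.\<close>

lemma (in banach_space_over) real_functional_factorization: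
  assumes f: "bounded_linear (f :: 'b \<Rightarrow> real)"
  obtains g :: "'b \<Rightarrow> 'k" and \<rho> :: "'k \<Rightarrow> real"
  where "Vector_Spaces.linear smul (*) g" "continuous_on UNIV g" "continuous_on UNIV \<rho>"
    "\<And>x. f x = \<rho> (g x)"
proof -
  interpret f: bounded_linear f by (rule f)
  have vs: "vector_space ((*) :: 'k \<Rightarrow> 'k \<Rightarrow> 'k)"
    by unfold_locales (auto simp: algebra_simps)
  have linI: "Vector_Spaces.linear smul (*) g"
    if "\<And>x y. g (x + y) = g x + g y" "\<And>c x. g (smul c x) = c * g x" for g :: "'b \<Rightarrow> 'k"
    using that vs vector_space_axioms
    by (simp add: Vector_Spaces.linear_iff)
  show thesis
  proof (cases "\<forall>z::'k. \<exists>a. z = a *\<^sub>R 1")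
    case True
    let ?\<rho> = "inv (of_real :: real \<Rightarrow> 'k)"
    have inv: "?\<rho> (of_real a) = a" for a
      by (simp add: inv_f_f inj_of_real)
    have surj: "\<exists>a. z = of_real a" for z :: 'k
      using True by (simp add: of_real_def)
    have "bounded_linear ?\<rho>"
    proof (rule bounded_linear_intro)
      fix x y :: 'k
      obtain a b where "x = of_real a" "y = of_real b" using surj by metis
      then show "?\<rho> (x + y) = ?\<rho> x + ?\<rho> y"
        by (simp add: inv flip: of_real_add)
    next
      fix r and x :: 'k
      obtain a where "x = of_real a" using surj by metis
      then show "?\<rho> (r *\<^sub>R x) = r *\<^sub>R ?\<rho> x"
        by (simp add: inv scaleR_conv_of_real flip: of_real_mult)
    next
      fix x :: 'k
      obtain a where "x = of_real a" using surj by metis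
      then show "norm (?\<rho> x) \<le> norm x * 1"
        by (simp add: inv)
    qed
    then have "continuous_on UNIV ?\<rho>" by (rule linear_continuous_on)
    moreover have "of_real (f (smul c x)) = c * of_real (f x)" for c x
    proof -
      obtain a where "c = of_real a" using surj by metis
      then show ?thesis by (simp add: scale_of_real f.scaleR)
    qed
    then have "Vector_Spaces.linear smul (*) (\<lambda>x. of_real (f x))"
      by (intro linI) (simp_all add: f.add)
    moreover have "continuous_on UNIV (\<lambda>x. of_real (f x) :: 'k)"
      by (intro continuous_intros linear_continuous_on f)
    ultimately show thesis
      using inv by (intro that[of "\<lambda>x. of_real (f x)" ?\<rho>]) auto
  next
    case False
    then obtain j :: 'k where j: "j * j = - 1" and span: "\<And>z. \<exists>a b. z = a *\<^sub>R 1 + b *\<^sub>R j"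
      using real_or_complex by blast
    have uniq: "a = a'" if "a *\<^sub>R 1 + b *\<^sub>R j = a' *\<^sub>R 1 + b' *\<^sub>R j" for a b a' b'
      using real_part_bound[OF j, of "a - a'" "b - b'"] that
      by (simp add: algebra_simps)
    define \<rho> where "\<rho> z = (SOME a. \<exists>b. z = a *\<^sub>R 1 + b *\<^sub>R j)" for z
    have \<rho>: "\<rho> (a *\<^sub>R 1 + b *\<^sub>R j) = a" for a b
      unfolding \<rho>_def by (rule some_equality) (use uniq in blast)+
    have "bounded_linear \<rho>"
    proof (rule bounded_linear_intro)
      fix x y
      obtain a b a' b' where xy: "x = a *\<^sub>R 1 + b *\<^sub>R j" "y = a' *\<^sub>R 1 + b' *\<^sub>R j" using span by metis
      have "x + y = (a + a') *\<^sub>R 1 + (b + b') *\<^sub>R j" using xy by (simp add: algebra_simps)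
      then show "\<rho> (x + y) = \<rho> x + \<rho> y" using xy by (simp only: \<rho>)
    next
      fix r x
      obtain a b where x: "x = a *\<^sub>R 1 + b *\<^sub>R j" using span by metis
      have "r *\<^sub>R x = (r * a) *\<^sub>R 1 + (r * b) *\<^sub>R j" using x by (simp add: algebra_simps)
      then show "\<rho> (r *\<^sub>R x) = r *\<^sub>R \<rho> x" using x by (simp only: \<rho> real_scaleR_def)
    next
      fix x
      obtain a b where x: "x = a *\<^sub>R 1 + b *\<^sub>R j" using span by metis
      have "\<bar>a\<bar> + \<bar>b\<bar> \<le> norm x * 2" using real_part_bound[OF j, of a b] x by (simp add: mult.commute)
      moreover have "\<rho> x = a" using x by (simp only: \<rho>)
      ultimately show "norm (\<rho> x) \<le> norm x * 2" by simp
    qed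
    then have cont_\<rho>: "continuous_on UNIV \<rho>" by (rule linear_continuous_on)
    define g where "g x = f x *\<^sub>R 1 + (- f (smul j x)) *\<^sub>R j" for x
    have smul_scaleR: "smul c (r *\<^sub>R x) = r *\<^sub>R smul c x" for c r x
      by (metis scale_left_commute scale_of_real)
    have g_scale: "g (smul c x) = c * g x" for c x
    proof -
      obtain a b where c: "c = a *\<^sub>R 1 + b *\<^sub>R j" using span by metis
      have jj: "smul j (smul j x) = - x"
        by (simp add: j)
      have cx: "smul c x = a *\<^sub>R x + b *\<^sub>R smul j x"
        by (metis c scale_left_distrib scaleR_conv_of_real scale_of_real scale_one scale_scale)
      have "g (smul c x) = (a * f x + b * f (smul j x)) *\<^sub>R 1 + (b * f x - a * f (smul j x)) *\<^sub>R j"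
        unfolding g_def cx by (simp add: f.add f.scaleR linear_neg[OF bounded_linear.linear[OF f]] scale_right_distrib smul_scaleR jj f.diff del: scale_scale)
      also have "\<dots> = c * g x"
        unfolding c g_def by (simp add: algebra_simps j)
      finally show ?thesis .
    qed
    have "Vector_Spaces.linear smul (*) g"
      by (rule linI) (auto simp: g_scale, simp add: g_def f.add scale_right_distrib algebra_simps)
    moreover have "bounded_linear (smul j)"
      by (rule bounded_linear_intro[where K = "norm j"])
        (auto simp: scale_right_distrib smul_scaleR norm_scale mult.commute)
    then have "continuous_on UNIV g"
      unfolding g_def
      by (intro continuous_intros linear_continuous_on f bounded_linear_compose[OF f])
    moreover have "f x = \<rho> (g x)" for x
      unfolding g_def \<rho> ..
    ultimately show thesis using cont_\<rho> by (intro that[of g \<rho>])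
  qed
qed

text \<open>The weak topology is generated by \<open>'k\<close>-linear functionals; this makes it accessible to real
  ones, which are what separation produces.\<close>

lemma (in banach_space_over) openin_weak_topology_vimage:
  assumes f: "bounded_linear (f :: 'b \<Rightarrow> real)" and U: "open U"
  shows "openin (weak_topology smul) (f -` U)"
proof -
  obtain g :: "'b \<Rightarrow> 'k" and \<rho> :: "'k \<Rightarrow> real"
    where g: "Vector_Spaces.linear smul (*) g" "continuous_on UNIV g" "continuous_on UNIV \<rho>"
      "\<And>x. f x = \<rho> (g x)"
    using real_functional_factorization[OF f] by blast
  have "open (\<rho> -` U)" using g(3) U by (rule open_vimage[rotated])
  moreover have "f -` U = g -` (\<rho> -` U)" using g(4) by auto
  ultimately show ?thesis
    using g(1,2) unfolding weak_topology_def
    by (intro topology_generated_by_Basis) blast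
qed

lemma (in banach_space_over) topspace_weak_topology: "topspace (weak_topology smul) = UNIV"
  using openin_subset[OF openin_weak_topology_vimage[OF bounded_linear_zero open_UNIV]] by auto

text \<open>Mazur's theorem: by separation, the complement is a union of weakly open half-spaces.\<close>

lemma (in banach_space_over) closedin_weak_topology_closed_convex:
  assumes "closed (C :: 'b set)" "convex C"
  shows "closedin (weak_topology smul) C"
proof -
  have "\<exists>U. openin (weak_topology smul) U \<and> x \<in> U \<and> U \<subseteq> - C" if x: "x \<in> - C" for x
  proof -
    obtain f :: "'b \<Rightarrow> real" and a where f: "bounded_linear f" "f x < a" "\<And>c. c \<in> C \<Longrightarrow> a \<le> f c"
      using separating_functional[OF assms, of x] x by blast
    show ?thesis
      using openin_weak_topology_vimage[OF f(1) open_lessThan[of a]] f(2,3)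
      by (intro exI[of _ "f -` {..<a}"]) force
  qed
  then have "openin (weak_topology smul) (- C)"
    by (subst openin_subopen) blast
  then show ?thesis
    by (simp add: closedin_def topspace_weak_topology Compl_eq_Diff_UNIV)
qed

lemma (in banach_space_over) weakly_compact_chain_Inter_nonempty:
  assumes V: "compactin (weak_topology smul) V"
    and C: "\<And>C. C \<in> \<C> \<Longrightarrow> C \<subseteq> V \<and> C \<noteq> {} \<and> closed C \<and> convex C"
    and chain: "\<And>C D. C \<in> \<C> \<Longrightarrow> D \<in> \<C> \<Longrightarrow> C \<subseteq> D \<or> D \<subseteq> C"
    and ne: "\<C> \<noteq> {}"
  shows "\<Inter>\<C> \<noteq> {}"
proof -
  have "V \<inter> \<Inter>\<C> \<noteq> {}"
  proof (rule compactin_fip[THEN iffD1, OF V, THEN conjunct2, rule_format])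
    have "V \<inter> \<Inter>\<F> \<noteq> {}" if "finite \<F>" "\<F> \<subseteq> \<C>" for \<F>
    proof (cases "\<F> = {}")
      case True
      then show ?thesis using ne C by fastforce
    next
      case False
      have "\<Inter>\<F> \<in> \<F>"
        using that False chain by (intro Inter_in_chain) (auto simp: subset_chain_def)
      then show ?thesis using that C by blast
    qed
    then show "(\<forall>C\<in>\<C>. closedin (weak_topology smul) C) \<and>
        (\<forall>\<F>. finite \<F> \<and> \<F> \<subseteq> \<C> \<longrightarrow> V \<inter> \<Inter>\<F> \<noteq> {})"
      using C closedin_weak_topology_closed_convex by blast
  qed
  then show ?thesis by blast
qed

section \<open>Chebyshev centers\<close>

lemma bdd_above_norm_diff:
  assumes "bounded K"
  shows "bdd_above ((\<lambda>y. norm (x - y)) ` K)"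
proof -
  obtain e where "\<forall>y\<in>K. dist x y \<le> e" using assms bounded_any_center by blast
  then show ?thesis by (intro bdd_aboveI2[where M = e]) (simp add: dist_norm)
qed

lemma cheb_radius_at_le_iff:
  assumes "bounded K" "K \<noteq> {}"
  shows "cheb_radius_at K x \<le> s \<longleftrightarrow> (\<forall>y\<in>K. norm (x - y) \<le> s)"
  unfolding cheb_radius_at_def
  using cSUP_le_iff[OF assms(2) bdd_above_norm_diff[OF assms(1)]] .

lemma cheb_radius_at_nonneg:
  assumes "bounded K" "K \<noteq> {}"
  shows "0 \<le> cheb_radius_at K x"
proof -
  obtain y where "y \<in> K" using assms(2) by auto
  then have "norm (x - y) \<le> cheb_radius_at K x"
    using cheb_radius_at_le_iff[OF assms, of x "cheb_radius_at K x"] by simp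
  then show ?thesis using norm_ge_zero order_trans by blast
qed

lemma cheb_center_iff:
  assumes "bounded K" "K \<noteq> {}"
  shows "x \<in> cheb_center K K \<longleftrightarrow> x \<in> K \<and> cheb_radius_at K x \<le> cheb_radius K K"
proof -
  have "cheb_radius K K \<le> cheb_radius_at K x" if "x \<in> K"
    unfolding cheb_radius_def
    using cheb_radius_at_nonneg[OF assms] that by (intro cINF_lower bdd_belowI2)
  then show ?thesis by (auto simp: cheb_center_def)
qed

lemma cheb_sublevel_eq_cballs:
  assumes "bounded K" "K \<noteq> {}"
  shows "{x \<in> K. cheb_radius_at K x \<le> s} = K \<inter> (\<Inter>y\<in>K. cball y s)"
  by (auto simp: cheb_radius_at_le_iff[OF assms] dist_norm norm_minus_commute)

lemma cheb_sublevel_closed_convex: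
  assumes "bounded K" "K \<noteq> {}" "closed K" "convex K"
  shows "closed {x \<in> K. cheb_radius_at K x \<le> s}" "convex {x \<in> K. cheb_radius_at K x \<le> s}"
  unfolding cheb_sublevel_eq_cballs[OF assms(1,2)]
  using assms by (auto intro!: closed_Int closed_INT convex_Int convex_INT)

lemma cheb_center_closed_convex:
  assumes "bounded K" "K \<noteq> {}" "closed K" "convex K"
  shows "closed (cheb_center K K)" "convex (cheb_center K K)"
proof -
  have "cheb_center K K = {x \<in> K. cheb_radius_at K x \<le> cheb_radius K K}"
    using cheb_center_iff[OF assms(1,2)] by blast
  then show "closed (cheb_center K K)" "convex (cheb_center K K)"
    using cheb_sublevel_closed_convex[OF assms] by simp_all
qed

text \<open>The center is the intersection of the chain of sublevel sets of the farthest distance above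
  the Chebyshev radius.\<close>

lemma (in banach_space_over) cheb_center_nonempty:
  assumes V: "compactin (weak_topology smul) V"
    and K: "K \<subseteq> V" "bounded K" "K \<noteq> {}" "closed K" "convex K"
  shows "cheb_center K K \<noteq> {}"
proof -
  define S where "S s = {x \<in> K. cheb_radius_at K x \<le> s}" for s
  have ne: "S s \<noteq> {}" if s: "s > cheb_radius K K" for s
  proof
    assume "S s = {}"
    then have "s \<le> cheb_radius_at K x" if "x \<in> K" for x
      using that by (force simp: S_def)
    then have "s \<le> cheb_radius K K"
      unfolding cheb_radius_def using K(3) by (intro cINF_greatest)
    then show False using s by simp
  qed
  have "\<Inter>(S ` {cheb_radius K K<..}) \<noteq> {}"
  proof (rule weakly_compact_chain_Inter_nonempty[OF V])
    fix C D assume "C \<in> S ` {cheb_radius K K<..}" "D \<in> S ` {cheb_radius K K<..}"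
    then obtain s t where "C = S s" "D = S t" by blast
    then show "C \<subseteq> D \<or> D \<subseteq> C"
      by (cases s t rule: le_cases) (auto simp: S_def)
  next
    fix C assume "C \<in> S ` {cheb_radius K K<..}"
    then obtain s where s: "C = S s" "s > cheb_radius K K" by auto
    show "C \<subseteq> V \<and> C \<noteq> {} \<and> closed C \<and> convex C"
      using ne[OF s(2)] cheb_sublevel_closed_convex[OF K(2-5), of s] K(1) by (auto simp: s(1) S_def)
  qed (use gt_ex in auto)
  then obtain x where x: "\<And>s. s > cheb_radius K K \<Longrightarrow> x \<in> S s" by blast
  have "x \<in> K" using x[of "cheb_radius K K + 1"] by (simp add: S_def)
  moreover have "cheb_radius_at K x \<le> cheb_radius K K"
    by (rule dense_ge) (use x in \<open>simp add: S_def\<close>)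
  ultimately show ?thesis using cheb_center_iff[OF K(2,3)] by blast
qed

lemma isometry_image_cheb_center:
  assumes iso: "\<And>x y. x \<in> K \<Longrightarrow> y \<in> K \<Longrightarrow> dist (f x) (f y) = dist x y" and surj: "f ` K = K"
  shows "f ` cheb_center K K = cheb_center K K"
proof -
  have "cheb_radius_at K (f x) = cheb_radius_at K x" if "x \<in> K" for x
  proof -
    have "cheb_radius_at K (f x) = (SUP y\<in>f ` K. norm (f x - y))"
      by (simp add: cheb_radius_at_def surj)
    also have "\<dots> = (SUP y\<in>K. norm (f x - f y))"
      by (simp add: image_image)
    also have "\<dots> = cheb_radius_at K x"
      unfolding cheb_radius_at_def using iso that by (intro SUP_cong) (auto simp: dist_norm)
    finally show ?thesis .
  qed
  then have mem: "f x \<in> cheb_center K K \<longleftrightarrow> x \<in> cheb_center K K" if "x \<in> K" for x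
    using that surj by (auto simp: cheb_center_def)
  have sub: "cheb_center K K \<subseteq> K" by (auto simp: cheb_center_def)
  show ?thesis
  proof
    show "f ` cheb_center K K \<subseteq> cheb_center K K" using mem sub by auto
    show "cheb_center K K \<subseteq> f ` cheb_center K K"
    proof
      fix y assume y: "y \<in> cheb_center K K"
      then obtain x where "x \<in> K" "y = f x" using sub surj by (metis imageE subsetD)
      then show "y \<in> f ` cheb_center K K" using mem y by auto
    qed
  qed
qed

text \<open>Normal structure says that some point of a nondegenerate \<open>C\<close> is closer to all of \<open>C\<close> than the
  diameter, whereas in a set that is its own center every point sees the diameter.\<close>

lemma normal_structure_self_center_singleton:
  assumes V: "normal_structure V" and C: "C \<subseteq> V" "C \<noteq> {}" "closed C" "convex C"
    and center: "cheb_center C C = C"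
  shows "\<exists>z. C = {z}"
proof (rule ccontr)
  assume "\<nexists>z. C = {z}"
  moreover obtain u where "u \<in> C" using C(2) by blast
  ultimately have "\<exists>u\<in>C. \<exists>v\<in>C. u \<noteq> v" by blast
  then obtain x where x: "x \<in> C" "cheb_radius_at C x < (SUP (z, y)\<in>C \<times> C. norm (z - y))"
    using V C unfolding normal_structure_def by blast
  have "bounded V" using V by (simp add: normal_structure_def)
  then have bdd: "bounded C" using C(1) by (rule bounded_subset)
  have const: "cheb_radius_at C z = cheb_radius C C" if "z \<in> C" for z
    using center that unfolding cheb_center_def by auto
  have "norm (z - y) \<le> cheb_radius_at C x" if "z \<in> C" "y \<in> C" for z y
  proof -
    have "cheb_radius_at C z = cheb_radius_at C x"
      using const that(1) x(1) by simp
    then show ?thesis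
      using cheb_radius_at_le_iff[OF bdd C(2), of z "cheb_radius_at C z"] that by simp
  qed
  then have "(SUP (z, y)\<in>C \<times> C. norm (z - y)) \<le> cheb_radius_at C x"
    using C(2) by (intro cSUP_least) auto
  then show False using x(2) by simp
qed

section \<open>Fixed points\<close>

text \<open>Invariance is \<open>f ` C = C\<close> rather than \<open>f ` C \<subseteq> C\<close>, since the Chebyshev center of a set
  is preserved only by maps onto the set; injectivity of \<open>f\<close> makes the stronger condition pass to
  intersections.\<close>

lemma (in banach_space_over) exists_minimal_invariant_set:
  assumes V: "compactin (weak_topology smul) V"
    and inj: "\<And>f. f \<in> G \<Longrightarrow> inj_on f V"
    and K: "K \<subseteq> V" "K \<noteq> {}" "closed K" "convex K" "\<And>f. f \<in> G \<Longrightarrow> f ` K = K"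
  obtains C where "C \<subseteq> K" "C \<noteq> {}" "closed C" "convex C" "\<And>f. f \<in> G \<Longrightarrow> f ` C = C"
    "\<And>D. D \<subseteq> C \<Longrightarrow> D \<noteq> {} \<Longrightarrow> closed D \<Longrightarrow> convex D \<Longrightarrow> (\<And>f. f \<in> G \<Longrightarrow> f ` D = D) \<Longrightarrow> D = C"
proof -
  let ?A = "{C. C \<subseteq> K \<and> C \<noteq> {} \<and> closed C \<and> convex C \<and> (\<forall>f\<in>G. f ` C = C)}"
  have "\<exists>U\<in>?A. \<forall>C\<in>\<C>. C \<supseteq> U" if chain: "\<C> \<in> Chains (relation_of (\<supseteq>) ?A)" for \<C>
  proof (cases "\<C> = {}")
    case True
    then show ?thesis using K by (intro bexI[of _ K]) auto
  next
    case False
    have A: "\<C> \<subseteq> ?A"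
      using chain by (rule Chains_relation_ofD)
    have tot: "C \<subseteq> D \<or> D \<subseteq> C" if "C \<in> \<C>" "D \<in> \<C>" for C D
      using Chains_relation_ofD(2)[OF chain that] by (rule disj_commute[THEN iffD1])
    have mem: "C \<subseteq> K" "C \<subseteq> V" "C \<noteq> {}" "closed C" "convex C" "\<And>f. f \<in> G \<Longrightarrow> f ` C = C"
      if "C \<in> \<C>" for C
      using subsetD[OF A that] K(1) by auto
    have "\<Inter>\<C> \<noteq> {}"
      using mem by (intro weakly_compact_chain_Inter_nonempty[OF V _ tot False] conjI)
    moreover have "f ` \<Inter>\<C> = \<Inter>\<C>" if f: "f \<in> G" for f
    proof -
      obtain C0 where C0: "C0 \<in> \<C>" using False by blast
      have "f ` (\<Inter>C\<in>\<C>. C) = (\<Inter>C\<in>\<C>. f ` C)"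
        using inj[OF f] _ C0 by (rule image_INT) (use mem(2) in simp)
      also have "\<dots> = (\<Inter>C\<in>\<C>. C)"
        using mem(6)[OF _ f] by (intro INF_cong) auto
      finally show ?thesis by simp
    qed
    moreover have "\<Inter>\<C> \<subseteq> K" using False mem(1) by blast
    moreover have "closed (\<Inter>\<C>)" "convex (\<Inter>\<C>)"
      using mem(4,5) by (auto intro: closed_Inter convex_Inter)
    ultimately have "\<Inter>\<C> \<in> ?A" by simp
    then show ?thesis by (rule bexI[rotated]) (simp add: Inter_lower)
  qed
  moreover have "partial_order_on ?A (relation_of (\<supseteq>) ?A)"
    by (rule partial_order_on_relation_ofI) auto
  ultimately have "\<exists>C\<in>?A. \<forall>D\<in>?A. C \<supseteq> D \<longrightarrow> D = C"
    by (intro predicate_Zorn)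
  then obtain C where C: "C \<in> ?A" and min: "\<forall>D\<in>?A. C \<supseteq> D \<longrightarrow> D = C" ..
  show thesis
  proof (rule that[of C])
    fix D assume D: "D \<subseteq> C" "D \<noteq> {}" "closed D" "convex D" "\<And>f. f \<in> G \<Longrightarrow> f ` D = D"
    moreover have "D \<subseteq> K" using D(1) C by auto
    ultimately have "D \<in> ?A" by simp
    then show "D = C" using min D(1) by simp
  qed (use C in simp_all)
qed

theorem (in banach_space_over) common_fixed_point_in_cheb_center:
  assumes V: "compactin (weak_topology smul) V" and ns: "normal_structure V"
    and iso: "\<And>f x y. f \<in> G \<Longrightarrow> x \<in> V \<Longrightarrow> y \<in> V \<Longrightarrow> dist (f x) (f y) = dist x y"
    and surj: "\<And>f. f \<in> G \<Longrightarrow> f ` V = V"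
  shows "\<exists>z\<in>cheb_center V V. \<forall>f\<in>G. f z = z"
proof -
  have V': "bounded V" "V \<noteq> {}" "closed V" "convex V"
    using ns by (auto simp: normal_structure_def)
  have center: "cheb_center V V \<subseteq> V" "cheb_center V V \<noteq> {}" "closed (cheb_center V V)"
    "convex (cheb_center V V)"
    using cheb_center_nonempty[OF V order_refl V'] cheb_center_closed_convex[OF V']
    by (auto simp: cheb_center_def)
  have "inj_on f V" if "f \<in> G" for f
    using iso[OF that] by (metis dist_eq_0_iff inj_onI)
  moreover have "f ` cheb_center V V = cheb_center V V" if "f \<in> G" for f
    using iso[OF that] surj[OF that] by (rule isometry_image_cheb_center)
  ultimately obtain C where C: "C \<subseteq> cheb_center V V" "C \<noteq> {}" "closed C" "convex C"
      "\<And>f. f \<in> G \<Longrightarrow> f ` C = C"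
    and min: "\<And>D. D \<subseteq> C \<Longrightarrow> D \<noteq> {} \<Longrightarrow> closed D \<Longrightarrow> convex D \<Longrightarrow> (\<And>f. f \<in> G \<Longrightarrow> f ` D = D) \<Longrightarrow> D = C"
    using exists_minimal_invariant_set[OF V _ center, of G] by metis
  have CV: "C \<subseteq> V" using C(1) center(1) by blast
  have bdd: "bounded C" using V'(1) CV by (rule bounded_subset)
  have "cheb_center C C = C"
  proof (rule min)
    show "cheb_center C C \<subseteq> C" by (auto simp: cheb_center_def)
    show "cheb_center C C \<noteq> {}" using V CV bdd C(2-4) by (rule cheb_center_nonempty)
    show "closed (cheb_center C C)" "convex (cheb_center C C)"
      using cheb_center_closed_convex[OF bdd C(2-4)] .
    show "f ` cheb_center C C = cheb_center C C" if "f \<in> G" for f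
      using iso[OF that] CV C(5)[OF that] by (intro isometry_image_cheb_center) blast+
  qed
  then obtain z where z: "C = {z}"
    using normal_structure_self_center_singleton[OF ns CV C(2-4)] by blast
  then show ?thesis using C(1,5) by auto
qed

lemma strong_random_element_const:
  assumes "z \<in> M"
  shows "strong_random_element P M (\<lambda>_. z)"
proof -
  have "(\<lambda>_. z) -` U \<inter> space P \<in> sets P" for U
    by (cases "z \<in> U") auto
  then have "simple_random_element P M (\<lambda>_. z)"
    using assms
    by (auto simp: simple_random_element_def random_element_def intro: finite_subset[of _ "{z}"])
  then show ?thesis
    using assms unfolding strong_random_element_def by (intro conjI exI[of _ "\<lambda>_ _. z"]) auto
qed

theorem theorem1p20:
  fixes P :: "'w measure"
    and smul :: "'k::real_or_complex \<Rightarrow> 'b::banach \<Rightarrow> 'b"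
    and V :: "'b set"
    and \<T> :: "('w \<Rightarrow> 'b \<Rightarrow> 'b) set"
  assumes "prob_space P"
    and "banach_space_over smul"
    and "compactin (weak_topology smul) V"
    and "convex V"
    and "normal_structure V"
    and "\<And>T. T \<in> \<T> \<Longrightarrow> strong_random_surjective_isometric_operator P V V T"
  shows "\<exists>x0. strong_random_element P (cheb_center V V) x0 \<and>
           (AE \<omega> in P. \<forall>T\<in>\<T>. T \<omega> (x0 \<omega>) = x0 \<omega>)"
proof -
  interpret banach_space_over smul by (rule assms(2))
  let ?G = "{T \<omega> | T \<omega>. T \<in> \<T> \<and> \<omega> \<in> space P}"
  have "dist (f x) (f y) = dist x y" if "f \<in> ?G" "x \<in> V" "y \<in> V" for f x y
    using that assms(6)
    by (auto simp: strong_random_surjective_isometric_operator_def random_isometric_def)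
  moreover have "f ` V = V" if f: "f \<in> ?G" for f
  proof -
    obtain T \<omega> where "f = T \<omega>" "T \<in> \<T>" "\<omega> \<in> space P" using f by auto
    then show ?thesis
      using assms(6)[of T]
      by (simp add: strong_random_surjective_isometric_operator_def random_surjective_def)
  qed
  ultimately obtain z where z: "z \<in> cheb_center V V" "\<forall>f\<in>?G. f z = z"
    using common_fixed_point_in_cheb_center[OF assms(3,5), of ?G] by auto
  have "AE \<omega> in P. \<forall>T\<in>\<T>. T \<omega> z = z"
    using z(2) by (intro AE_I2) auto
  then show ?thesis
    using strong_random_element_const[OF z(1)] by (intro exI[of _ "\<lambda>_. z"]) simp
qed

end
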